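(* Let $1<\alpha<2$, $a<b$, and $f:[a,b]\times\mathbb{R}\to\mathbb{R}$. Let $\underline{\sigma},\overline{\sigma}$ be a lower and an upper solution, respectively, of problem (P): $$T^a_\alpha u(t)+f(t,u(t))=0\ \ (a<t<b),\qquad u(a)=u(b)=0,$$ with $\underline{\sigma}(t)\le\overline{\sigma}(t)$ for all $t\in[a,b]$. Let $E=\{(t,x)\in[a,b]\times\mathbb{R}:\underline{\sigma}(t)\le x\le\overline{\sigma}(t)\}$ and assume $f$ is continuous on $E$. Then (P) has at least one solution $u\in AC^2[a,b]$, twice differentiable on $(a,b)$, such that $\underline{\sigma}(t)\le u(t)\le\overline{\sigma}(t)$ for all $t\in[a,b]$.
   Context: Conformable derivative: for $0<\beta<1$ and a function $h:[a,\infty)\to\mathbb{R}$, $T^a_\beta h(t)=\lim_{\varepsilon\to0}\frac{h(t+\varepsilon(t-a)^{1-\beta})-h(t)}{\varepsilon}$ for $t>a$, whenever the limit exists. For $1<\alpha<2$ and $g$ with derivative $g'$, $T^a_\alpha g(t)=T^a_{\alpha-1}g'(t)$; for $t>a$ this exists iff $g'$ is differentiable at $t$, and then $T^a_\alpha g(t)=(t-a)^{2-\alpha}g''(t)$. $AC^2[a,b]=\{u\in C^1[a,b]: u'\text{ absolutely continuous on }[a,b]\}$. A lower solution of (P) is $\underline{\sigma}\in AC^2[a,b]$, twice differentiable on $(a,b)$, with $T^a_\alpha\underline{\sigma}(t)+f(t,\underline{\sigma}(t))\ge0$ for all $t\in(a,b)$ and $\underline{\sigma}(a)\le0$, $\underline{\sigma}(b)\le0$.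 An upper solution of (P) is $\overline{\sigma}\in AC^2[a,b]$, twice differentiable on $(a,b)$, with $T^a_\alpha\overline{\sigma}(t)+f(t,\overline{\sigma}(t))\le0$ for all $t\in(a,b)$ and $\overline{\sigma}(a)\ge0$, $\overline{\sigma}(b)\ge0$. A solution of (P) satisfies the equation at every $t\in(a,b)$ and the boundary conditions. *)

theory Defs
  imports "HOL-Analysis.Analysis"
begin

definition abs_cont_on :: "real \<Rightarrow> real \<Rightarrow> (real \<Rightarrow> real) \<Rightarrow> bool" where
  "abs_cont_on a b h \<longleftrightarrow>
     (\<forall>e>0. \<exists>d>0. \<forall>(n::nat) (x::nat \<Rightarrow> real) (y::nat \<Rightarrow> real).
        (\<forall>i<n. a \<le> x i \<and> x i \<le> y i \<and> y i \<le> b) \<and>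
        (\<forall>i<n. \<forall>j<n. i \<noteq> j \<longrightarrow> y i \<le> x j \<or> y j \<le> x i) \<and>
        (\<Sum>i<n. y i - x i) < d
        \<longrightarrow> (\<Sum>i<n. \<bar>h (y i) - h (x i)\<bar>) < e)"

definition AC2 :: "real \<Rightarrow> real \<Rightarrow> (real \<Rightarrow> real) \<Rightarrow> bool" where
  "AC2 a b u \<longleftrightarrow>
     (\<exists>u'. (\<forall>t\<in>{a..b}. (u has_real_derivative u' t) (at t within {a..b})) \<and>
           continuous_on {a..b} u' \<and> abs_cont_on a b u')"

text \<open>Conformable derivative of order 0<beta<1 based at a: L is the value of the limit.\<close>
definition conf_has_deriv :: "real \<Rightarrow> real \<Rightarrow> (real \<Rightarrow> real) \<Rightarrow> real \<Rightarrow> real \<Rightarrow> bool" where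
  "conf_has_deriv \<beta> a h t L \<longleftrightarrow>
     ((\<lambda>\<epsilon>. (h (t + \<epsilon> * (t - a) powr (1 - \<beta>)) - h t) / \<epsilon>) \<longlongrightarrow> L) (at 0)"

definition conf_has_deriv2 :: "real \<Rightarrow> real \<Rightarrow> (real \<Rightarrow> real) \<Rightarrow> real \<Rightarrow> real \<Rightarrow> bool" where
  "conf_has_deriv2 \<alpha> a g t L \<longleftrightarrow> conf_has_deriv (\<alpha> - 1) a (deriv g) t L"

definition twice_diff_on :: "real set \<Rightarrow> (real \<Rightarrow> real) \<Rightarrow> bool" where
  "twice_diff_on S g \<longleftrightarrow> (\<forall>t\<in>S. g differentiable (at t) \<and> (deriv g) differentiable (at t))"

definition lower_sol :: "real \<Rightarrow> real \<Rightarrow> real \<Rightarrow> (real \<Rightarrow> real \<Rightarrow> real) \<Rightarrow> (real \<Rightarrow> real) \<Rightarrow> bool" where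
  "lower_sol \<alpha> a b f s \<longleftrightarrow> AC2 a b s \<and> twice_diff_on {a<..<b} s \<and>
     (\<forall>t\<in>{a<..<b}. \<exists>L. conf_has_deriv2 \<alpha> a s t L \<and> L + f t (s t) \<ge> 0) \<and>
     s a \<le> 0 \<and> s b \<le> 0"

definition upper_sol :: "real \<Rightarrow> real \<Rightarrow> real \<Rightarrow> (real \<Rightarrow> real \<Rightarrow> real) \<Rightarrow> (real \<Rightarrow> real) \<Rightarrow> bool" where
  "upper_sol \<alpha> a b f s \<longleftrightarrow> AC2 a b s \<and> twice_diff_on {a<..<b} s \<and>
     (\<forall>t\<in>{a<..<b}. \<exists>L. conf_has_deriv2 \<alpha> a s t L \<and> L + f t (s t) \<le> 0) \<and>
     s a \<ge> 0 \<and> s b \<ge> 0"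

definition is_sol :: "real \<Rightarrow> real \<Rightarrow> real \<Rightarrow> (real \<Rightarrow> real \<Rightarrow> real) \<Rightarrow> (real \<Rightarrow> real) \<Rightarrow> bool" where
  "is_sol \<alpha> a b f u \<longleftrightarrow>
     (\<forall>t\<in>{a<..<b}. \<exists>L. conf_has_deriv2 \<alpha> a u t L \<and> L + f t (u t) = 0) \<and>
     u a = 0 \<and> u b = 0"

end

theory Submission
  imports Defs "HOL-Complex_Analysis.Great_Picard"
begin

text \<open>
  The equation is \<open>u'' = - w F(t, u)\<close> with the weight \<open>w t = (t - a) powr (\<alpha> - 2) = A' t\<close>, where
  \<open>A t = (t - a) powr (\<alpha> - 1) / (\<alpha> - 1)\<close> is continuous at \<open>a\<close>; so it reads \<open>du = v dt\<close>,
  \<open>dv = - F(t, u) dA\<close>, and the singularity disappears. Here \<open>F\<close> is \<open>f\<close> truncated to the strip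
  between the lower and upper solutions, minus a bounded penalty that has the sign of the
  displacement from the strip. For bounded \<open>F\<close> a solution with \<open>u a = u b = 0\<close> is a limit of Euler
  polygons: the endpoint of a polygon is continuous in the initial slope, so the intermediate
  value theorem yields one ending at \<open>0\<close>, and the Arzela-Ascoli theorem gives a limit. This
  shooting argument replaces Schauder's theorem. Because of the penalty, \<open>u - su\<close> would have a
  strictly positive second derivative at an interior positive maximum, and similarly for
  \<open>sl - u\<close>; hence \<open>u\<close> stays in the strip, where \<open>F = f\<close>.
\<close>

section \<open>Step integrals and the Euler scheme\<close>

text \<open>The Stieltjes integral with respect to \<open>A\<close>, from \<open>p 0\<close> to
  \<open>t\<close>, of the step function with value \<open>g j\<close> on the \<open>j\<close>-th
  grid interval. Clamping makes an interval to the right of \<open>t\<close> contribute 0, so one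
  sum serves every \<open>t\<close> without locating it in the grid.\<close>

definition step_int :: "nat \<Rightarrow> (nat \<Rightarrow> real) \<Rightarrow> (real \<Rightarrow> real) \<Rightarrow> (nat \<Rightarrow> real) \<Rightarrow> real \<Rightarrow> real" where
  "step_int n p A g t = (\<Sum>j<n. g j * (A (max (p j) (min t (p (Suc j)))) - A (p j)))"

lemma step_int_one:
  assumes "mono p" "p 0 \<le> t"
  shows "step_int n p A (\<lambda>_. 1) t = A (min t (p n)) - A (p 0)"
proof (induction n)
  case 0
  then show ?case using assms by (simp add: step_int_def min_absorb2)
next
  case (Suc n)
  have "p 0 \<le> p n" "p n \<le> p (Suc n)" using assms(1) by (auto intro: monoD)
  then have "A (max (p n) (min t (p (Suc n)))) - A (p n) = A (min t (p (Suc n))) - A (min t (p n))"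
    by (cases "t \<le> p n") (auto simp: max_def min_def)
  then show ?case using Suc by (simp add: step_int_def)
qed

text \<open>At a node every interval counts either in full or not at all; this is the bridge to the
  sums produced by the Euler recursion.\<close>

lemma step_int_at_node:
  assumes "mono p" "i \<le> n"
  shows "step_int n p A g (p i) = (\<Sum>j<i. g j * (A (p (Suc j)) - A (p j)))"
proof -
  have "step_int n p A g (p i) = (\<Sum>j<i. g j * (A (max (p j) (min (p i) (p (Suc j)))) - A (p j)))"
    unfolding step_int_def
  proof (rule sum.mono_neutral_right)
    show "\<forall>j\<in>{..<n} - {..<i}. g j * (A (max (p j) (min (p i) (p (Suc j)))) - A (p j)) = 0"
    proof
      fix j assume "j \<in> {..<n} - {..<i}"
      then have "p i \<le> p j" "p j \<le> p (Suc j)" using assms(1) by (auto intro!: monoD[OF assms(1)])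
      then show "g j * (A (max (p j) (min (p i) (p (Suc j)))) - A (p j)) = 0"
        by (auto simp: max_def min_def)
    qed
  qed (use assms in auto)
  also have "\<dots> = (\<Sum>j<i. g j * (A (p (Suc j)) - A (p j)))"
  proof (rule sum.cong)
    fix j assume "j \<in> {..<i}"
    then have "p (Suc j) \<le> p i" "p j \<le> p (Suc j)" by (auto intro!: monoD[OF assms(1)])
    then show "g j * (A (max (p j) (min (p i) (p (Suc j)))) - A (p j)) = g j * (A (p (Suc j)) - A (p j))"
      by (auto simp: max_def min_def)
  qed simp
  finally show ?thesis .
qed

text \<open>Only intervals meeting the gap between \<open>s\<close> and \<open>t\<close> contribute,
  with nonnegative increments of \<open>A\<close> that telescope to \<open>A t - A s\<close>. With
  \<open>L = 0\<close> this gives a priori bounds, and with \<open>L\<close> the local value of the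
  integrand it gives derivatives in the limit.\<close>

lemma step_int_increment:
  assumes p: "mono p" and A: "mono_on {p 0..p n} A"
    and st: "p 0 \<le> s" "s \<le> t" "t \<le> p n"
    and g: "\<And>j. j < n \<Longrightarrow> p j < t \<Longrightarrow> s < p (Suc j) \<Longrightarrow> \<bar>g j - L\<bar> \<le> e"
  shows "\<bar>step_int n p A g t - step_int n p A g s - L * (A t - A s)\<bar> \<le> e * (A t - A s)"
proof -
  define c where "c x j = max (p j) (min x (p (Suc j)))" for x j
  define D where "D j = A (c t j) - A (c s j)" for j
  have tot: "(\<Sum>j<n. D j) = A t - A s"
  proof -
    have "(\<Sum>j<n. D j) = step_int n p A (\<lambda>_. 1) t - step_int n p A (\<lambda>_. 1) s"
      by (simp add: D_def c_def step_int_def flip: sum_subtractf)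
    then show ?thesis using st p by (simp add: step_int_one min_absorb1)
  qed
  have each: "\<bar>(g j - L) * D j\<bar> \<le> e * D j" if j: "j < n" for j
  proof -
    have ps: "p 0 \<le> p j" "p j \<le> p (Suc j)" "p (Suc j) \<le> p n" using p j by (auto intro!: monoD[OF p])
    have "c t j \<in> {p 0..p n}" "c s j \<in> {p 0..p n}" "c s j \<le> c t j"
      using ps st unfolding c_def by (auto simp: max_def min_def)
    then have D: "D j \<ge> 0" unfolding D_def by (auto intro: mono_onD[OF A])
    show ?thesis
    proof (cases "p j < t \<and> s < p (Suc j)")
      case True
      then show ?thesis using g[OF j] D by (simp add: abs_mult mult_right_mono)
    next
      case False
      then have "c t j = c s j" using ps st unfolding c_def by (auto simp: max_def min_def)
      then show ?thesis by (simp add: D_def)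
    qed
  qed
  have "step_int n p A g t - step_int n p A g s - L * (A t - A s) = (\<Sum>j<n. (g j - L) * D j)"
    unfolding tot[symmetric] step_int_def D_def c_def
    by (simp add: sum_distrib_left algebra_simps flip: sum_subtractf sum.distrib)
  also have "\<bar>\<dots>\<bar> \<le> (\<Sum>j<n. e * D j)"
    by (rule order_trans[OF sum_abs sum_mono]) (use each in auto)
  also have "\<dots> = e * (A t - A s)" by (simp add: tot flip: sum_distrib_left)
  finally show ?thesis .
qed

text \<open>Explicit Euler scheme for \<open>du = v dt\<close>, \<open>dv = - F(t, u) dA\<close>,
  started at \<open>(0, c)\<close>. The second component uses exact increments of \<open>A\<close>,
  so a density of \<open>A\<close> that blows up at an endpoint is never evaluated.\<close>

fun euler :: "(real \<Rightarrow> real \<Rightarrow> real) \<Rightarrow> (real \<Rightarrow> real) \<Rightarrow> (nat \<Rightarrow> real) \<Rightarrow> real \<Rightarrow> nat \<Rightarrow> real \<times> real" where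
  "euler F A p c 0 = (0, c)"
| "euler F A p c (Suc i) = (case euler F A p c i of (u, v) \<Rightarrow>
     (u + v * (p (Suc i) - p i), v - F (p i) u * (A (p (Suc i)) - A (p i))))"

lemma fst_euler: "fst (euler F A p c i) = (\<Sum>j<i. snd (euler F A p c j) * (p (Suc j) - p j))"
  by (induction i) (auto split: prod.splits)

lemma snd_euler: "snd (euler F A p c i) = c + (\<Sum>j<i. - F (p j) (fst (euler F A p c j)) * (A (p (Suc j)) - A (p j)))"
  by (induction i) (auto split: prod.splits)

lemma continuous_on_euler:
  assumes "\<And>t. t \<in> p ` {..<n} \<Longrightarrow> continuous_on UNIV (F t)" "i \<le> n"
  shows "continuous_on UNIV (\<lambda>c. fst (euler F A p c i)) \<and> continuous_on UNIV (\<lambda>c. snd (euler F A p c i))"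
  using assms(2)
proof (induction i)
  case (Suc i)
  have "continuous_on UNIV (\<lambda>c. F (p i) (fst (euler F A p c i)))"
    using continuous_on_compose2[OF assms(1)[of "p i"]] Suc by auto
  then show ?case using Suc by (auto simp: split_beta intro!: continuous_intros)
qed auto

text \<open>The second component never departs from its initial value \<open>c\<close> by more than
  \<open>K\<close>, the bound \<open>M\<close> times the total increment of \<open>A\<close>. So
  \<open>c = K\<close> keeps all slopes nonnegative, \<open>c = -K\<close> keeps them nonpositive,
  and the intermediate value theorem in \<open>c\<close> applies.\<close>

lemma euler_shooting:
  assumes p: "mono p" and A: "mono_on {p 0..p n} A"
    and F: "\<And>t. t \<in> {p 0..p n} \<Longrightarrow> continuous_on UNIV (F t)"
    and M: "\<And>t x. t \<in> {p 0..p n} \<Longrightarrow> \<bar>F t x\<bar> \<le> M"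
  obtains c where "\<bar>c\<bar> \<le> M * (A (p n) - A (p 0))" "fst (euler F A p c n) = 0"
proof -
  define K where "K = M * (A (p n) - A (p 0))"
  have pin: "p i \<in> {p 0..p n}" if "i \<le> n" for i using that by (auto intro!: monoD[OF p])
  have "0 \<le> M" using M[of "p 0" 0] pin[of 0] by simp
  have vb: "\<bar>snd (euler F A p c i) - c\<bar> \<le> K" if i: "i \<le> n" for c i
  proof -
    let ?g = "\<lambda>j. - F (p j) (fst (euler F A p c j))"
    have "\<bar>step_int n p A ?g (p i) - step_int n p A ?g (p 0) - 0 * (A (p i) - A (p 0))\<bar> \<le> M * (A (p i) - A (p 0))"
      by (rule step_int_increment[OF p A]) (use pin[OF i] M pin in auto)
    also have "\<dots> \<le> K" unfolding K_def using A pin[OF i] pin[of n] pin[of 0] \<open>0 \<le> M\<close>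
      by (intro mult_left_mono diff_right_mono mono_onD[OF A]) auto
    finally show ?thesis using i p by (simp add: step_int_at_node snd_euler[of F A p c i])
  qed
  have pd: "p (Suc j) - p j \<ge> 0" for j using p by (simp add: monoD)
  have "fst (euler F A p K n) \<ge> 0"
    unfolding fst_euler using vb[of _ K] pd by (intro sum_nonneg mult_nonneg_nonneg) (auto simp: abs_le_iff)
  moreover have "fst (euler F A p (-K) n) \<le> 0"
    unfolding fst_euler
  proof (intro sum_nonpos mult_nonpos_nonneg pd)
    fix j assume "j \<in> {..<n}"
    then show "snd (euler F A p (- K) j) \<le> 0" using vb[of j "-K"] by auto
  qed
  moreover have "0 \<le> K" using vb[of 0 0] by simp
  moreover have "continuous_on UNIV (\<lambda>c. fst (euler F A p c n))"
    using continuous_on_euler[of p n F n A] F pin by force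
  then have "continuous_on {-K..K} (\<lambda>c. fst (euler F A p c n))" 
    by (rule continuous_on_subset) simp
  ultimately obtain c where "-K \<le> c" "c \<le> K" "fst (euler F A p c n) = 0"
    using IVT'[of "\<lambda>c. fst (euler F A p c n)" "-K" 0 K] by auto
  then show thesis by (intro that[of c]) (auto simp: K_def)
qed

section \<open>Passage to the limit\<close>

text \<open>Indices are not capped at \<open>m\<close>: the equidistant points continue past
  \<open>b\<close>, so the grid is monotone on all natural numbers, as the step integral lemmas
  ask.\<close>

definition grid :: "real \<Rightarrow> real \<Rightarrow> nat \<Rightarrow> nat \<Rightarrow> real" where
  "grid a b m j = a + (b - a) * real j / real m"

lemma mono_grid: "a \<le> b \<Longrightarrow> mono (grid a b m)"
  by (auto simp: grid_def mono_def intro!: divide_right_mono mult_left_mono)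

lemma grid_0 [simp]: "grid a b m 0 = a"
  by (simp add: grid_def)

lemma grid_last [simp]: "m > 0 \<Longrightarrow> grid a b m m = b"
  by (simp add: grid_def)

lemma grid_Suc: "grid a b m (Suc j) = grid a b m j + (b - a) / real m"
  by (simp add: grid_def ring_distribs add_divide_distrib diff_divide_distrib)

text \<open>A fundamental theorem of calculus for limits of step integrals:
  \<open>dS = g0 dA\<close> at each point where \<open>A\<close> is differentiable. The increment
  estimate survives the pointwise limit, so no Stieltjes integral of \<open>g0\<close> has to be
  constructed.\<close>

lemma step_int_limit_has_derivative:
  fixes g :: "nat \<Rightarrow> real \<Rightarrow> real"
  assumes ab: "a < b" and m: "filterlim m at_top sequentially" "\<And>n. m n > 0"
    and A: "mono_on {a..b} A"
    and g: "uniform_limit {a..b} g g0 sequentially" "continuous_on {a..b} g0"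
    and S: "\<And>t. t \<in> {a..b} \<Longrightarrow>
      (\<lambda>n. C n + step_int (m n) (grid a b (m n)) A (\<lambda>j. g n (grid a b (m n) j)) t) \<longlonglongrightarrow> S t"
    and t0: "t0 \<in> {a..b}" and D: "(A has_real_derivative D) (at t0 within {a..b})"
  shows "(S has_real_derivative g0 t0 * D) (at t0 within {a..b})"
proof -
  define T where "T n = (\<lambda>t. C n + step_int (m n) (grid a b (m n)) A (\<lambda>j. g n (grid a b (m n) j)) t)" for n
  have incr: "\<exists>d>0. \<forall>s\<in>{a..b}. \<forall>t\<in>{a..b}. s \<le> t \<and> \<bar>s - t0\<bar> < d \<and> \<bar>t - t0\<bar> < d \<longrightarrow>
      \<bar>S t - S s - g0 t0 * (A t - A s)\<bar> \<le> e * (A t - A s)" if e: "e > 0" for e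
  proof -
    obtain d where d: "d > 0" "\<And>x. x \<in> {a..b} \<Longrightarrow> \<bar>x - t0\<bar> < d \<Longrightarrow> \<bar>g0 x - g0 t0\<bar> < e / 2"
      using g(2) t0 half_gt_zero[OF e] unfolding continuous_on_iff dist_real_def by metis
    \<comment> \<open>Both \<open>s\<close> and \<open>t\<close> lie within \<open>d / 2\<close> of
      \<open>t0\<close>, while the left node of an interval meeting the gap may lie one mesh width
      further left, hence within \<open>d\<close>. The error \<open>e\<close> is shared between
      continuity of \<open>g0\<close> and uniform convergence of \<open>g n\<close>.\<close>
    have "\<bar>S t - S s - g0 t0 * (A t - A s)\<bar> \<le> e * (A t - A s)"
      if st: "s \<in> {a..b}" "t \<in> {a..b}" "s \<le> t" "\<bar>s - t0\<bar> < d / 2" "\<bar>t - t0\<bar> < d / 2" for s t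
    proof (rule tendsto_upperbound)
      show "(\<lambda>n. \<bar>T n t - T n s - g0 t0 * (A t - A s)\<bar>) \<longlonglongrightarrow> \<bar>S t - S s - g0 t0 * (A t - A s)\<bar>"
        unfolding T_def by (intro tendsto_intros S st)
      have "(\<lambda>n. (b - a) / real (m n)) \<longlonglongrightarrow> 0"
        by (intro real_tendsto_divide_at_top[OF tendsto_const]
            filterlim_compose[OF filterlim_real_sequentially m(1)])
      then have ev1: "\<forall>\<^sub>F n in sequentially. (b - a) / real (m n) < d / 2"
        by (rule order_tendstoD) (use d in auto)
      have ev2: "\<forall>\<^sub>F n in sequentially. \<forall>x\<in>{a..b}. dist (g n x) (g0 x) < e / 2"
        by (rule uniform_limitD[OF g(1)]) (use e in simp)
      show "\<forall>\<^sub>F n in sequentially. \<bar>T n t - T n s - g0 t0 * (A t - A s)\<bar> \<le> e * (A t - A s)"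
        using ev1 ev2
      proof eventually_elim
        case (elim n)
        let ?p = "grid a b (m n)"
        have "\<bar>step_int (m n) ?p A (\<lambda>j. g n (?p j)) t - step_int (m n) ?p A (\<lambda>j. g n (?p j)) s
            - g0 t0 * (A t - A s)\<bar> \<le> e * (A t - A s)"
        proof (rule step_int_increment)
          fix j assume j: "j < m n" "?p j < t" "s < ?p (Suc j)"
          have "?p 0 \<le> ?p j" "?p j \<le> ?p (m n)"
            using j ab by (auto intro!: monoD[OF mono_grid] simp del: grid_0 grid_last)
          then have "?p j \<in> {a..b}" using m by simp
          moreover have "\<bar>?p j - t0\<bar> < d"
            using j st elim(1) unfolding grid_Suc by linarith
          ultimately have "\<bar>g0 (?p j) - g0 t0\<bar> < e / 2" "\<bar>g n (?p j) - g0 (?p j)\<bar> < e / 2"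
            using d elim(2) by (auto simp: dist_real_def)
          then show "\<bar>g n (?p j) - g0 t0\<bar> \<le> e" by linarith
        qed (use ab m A st mono_grid[of a b] in auto)
        then show ?case by (simp add: T_def)
      qed
    qed simp
    then show ?thesis using d(1) by (intro exI[of _ "d/2"]) auto
  qed
  define q where "q y = (A y - A t0) / (y - t0)" for y
  have q: "(q \<longlongrightarrow> D) (at t0 within {a..b})"
    using D unfolding has_field_derivative_iff q_def .
  have "((\<lambda>y. (S y - S t0) / (y - t0) - g0 t0 * q y) \<longlongrightarrow> 0) (at t0 within {a..b})"
  proof (rule tendstoI)
    fix e :: real assume e: "e > 0"
    \<comment> \<open>Near \<open>t0\<close> the quotient \<open>q\<close> stays below
      \<open>\<bar>D\<bar> + 1\<close> in absolute value, so a relative error \<open>e'\<close> in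
      the increments costs less than \<open>e\<close>.\<close>
    define e' where "e' = e / (\<bar>D\<bar> + 2)"
    have e': "e' > 0" using e by (simp add: e'_def)
    obtain d where d: "d > 0" "\<And>s t. s \<in> {a..b} \<Longrightarrow> t \<in> {a..b} \<Longrightarrow> s \<le> t \<Longrightarrow> \<bar>s - t0\<bar> < d \<Longrightarrow> \<bar>t - t0\<bar> < d \<Longrightarrow>
      \<bar>S t - S s - g0 t0 * (A t - A s)\<bar> \<le> e' * (A t - A s)"
      using incr[OF e'] by blast
    have "\<forall>\<^sub>F y in at t0 within {a..b}. dist (q y) D < 1"
      using tendstoD[OF q, of 1] by simp
    moreover have "\<forall>\<^sub>F y in at t0 within {a..b}. y \<in> {a..b} \<and> y \<noteq> t0 \<and> \<bar>y - t0\<bar> < d"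
      unfolding eventually_at dist_real_def using d(1) by (intro exI[of _ d]) auto
    ultimately show "\<forall>\<^sub>F y in at t0 within {a..b}. dist ((S y - S t0) / (y - t0) - g0 t0 * q y) 0 < e"
    proof eventually_elim
      case (elim y)
      have "\<bar>S y - S t0 - g0 t0 * (A y - A t0)\<bar> \<le> e' * \<bar>A y - A t0\<bar>"
      proof (cases "t0 \<le> y")
        case True
        then show ?thesis using d(2)[of t0 y] elim t0 d(1) mono_onD[OF A, of t0 y] by auto
      next
        case False
        then have "\<bar>S t0 - S y - g0 t0 * (A t0 - A y)\<bar> \<le> e' * (A t0 - A y)" "A y \<le> A t0"
          using d(2)[of y t0] elim t0 d(1) mono_onD[OF A, of y t0] by auto
        moreover have "S y - S t0 - g0 t0 * (A y - A t0) = - (S t0 - S y - g0 t0 * (A t0 - A y))"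
          by (simp add: algebra_simps)
        ultimately show ?thesis by (simp only: abs_minus_cancel) auto
      qed
      moreover have "(S y - S t0) / (y - t0) - g0 t0 * q y = (S y - S t0 - g0 t0 * (A y - A t0)) / (y - t0)"
        by (simp add: q_def diff_divide_distrib right_diff_distrib)
      ultimately have "\<bar>(S y - S t0) / (y - t0) - g0 t0 * q y\<bar> \<le> e' * \<bar>A y - A t0\<bar> / \<bar>y - t0\<bar>"
        by (simp add: divide_right_mono)
      also have "\<dots> = e' * \<bar>q y\<bar>" by (simp add: q_def)
      also have "\<dots> < e' * (\<bar>D\<bar> + 2)"
        using elim e' by (intro mult_strict_left_mono) (auto simp: dist_real_def)
      also have "\<dots> = e" by (simp add: e'_def)
      finally show ?case by simp
    qed
  qed
  from tendsto_add[OF this tendsto_mult[OF tendsto_const[of "g0 t0"] q]] show ?thesis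
    unfolding has_field_derivative_iff by simp
qed

section \<open>The Dirichlet problem with bounded right-hand side\<close>

text \<open>The derivative of \<open>v\<close> is claimed only where \<open>A\<close> has one, since
  the intended \<open>A\<close> has infinite slope at \<open>a\<close>. The increment bound on
  \<open>v\<close> is exported because it will yield absolute continuity up to that
  endpoint.\<close>

lemma dirichlet_solution:
  fixes A :: "real \<Rightarrow> real" and F :: "real \<Rightarrow> real \<Rightarrow> real"
  assumes ab: "a < b"
    and A: "mono_on {a..b} A" "continuous_on {a..b} A"
    and F: "continuous_on ({a..b} \<times> UNIV) (\<lambda>(t, x). F t x)"
    and M: "\<And>t x. t \<in> {a..b} \<Longrightarrow> \<bar>F t x\<bar> \<le> M"
  obtains u v where "u a = 0" "u b = 0" "continuous_on {a..b} v"
    and "\<And>t. t \<in> {a..b} \<Longrightarrow> (u has_real_derivative v t) (at t within {a..b})"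
    and "\<And>s t. a \<le> s \<Longrightarrow> s \<le> t \<Longrightarrow> t \<le> b \<Longrightarrow> \<bar>v t - v s\<bar> \<le> M * (A t - A s)"
    and "\<And>t D. t \<in> {a..b} \<Longrightarrow> (A has_real_derivative D) (at t within {a..b}) \<Longrightarrow>
      (v has_real_derivative - F t (u t) * D) (at t within {a..b})"
proof -
  \<comment> \<open>\<open>Suc n\<close> intervals, so that the mesh is never divided by
    zero.\<close>
  define p where "p n = grid a b (Suc n)" for n
  define K where "K = M * (A b - A a)"
  have p: "mono (p n)" "p n 0 = a" "p n (Suc n) = b" for n
    using ab by (simp_all add: p_def mono_grid)
  have pin: "p n j \<in> {a..b}" if "j \<le> Suc n" for n j
    using monoD[OF p(1)[of n], of 0 j] monoD[OF p(1)[of n], of j "Suc n"] that p by simp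
  have M0: "0 \<le> M" using M[of a 0] ab by simp
  have K0: "0 \<le> K" using M0 mono_onD[OF A(1), of a b] ab by (simp add: K_def)
  have Ft: "continuous_on UNIV (F t)" if "t \<in> {a..b}" for t
  proof -
    have "continuous_on UNIV (\<lambda>x. case (t, x) of (t, x) \<Rightarrow> F t x)"
      by (rule continuous_on_compose2[OF F]) (use that in \<open>auto intro!: continuous_intros\<close>)
    then show ?thesis by simp
  qed
  have "\<exists>c. \<bar>c\<bar> \<le> K \<and> fst (euler F A (p n) c (Suc n)) = 0" for n
    using euler_shooting[OF p(1), of n "Suc n" A F M] A Ft M unfolding p K_def by metis
  then obtain c where c: "\<And>n. \<bar>c n\<bar> \<le> K" "\<And>n. fst (euler F A (p n) (c n) (Suc n)) = 0"
    by metis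
  define E where "E n = euler F A (p n) (c n)" for n
  \<comment> \<open>\<open>V\<close> and \<open>U\<close> interpolate the Euler values by step
    integrals, against \<open>A\<close> and against the identity. Since they agree with those values
    at the nodes, the coefficients can later be read as \<open>- F\<close> along \<open>U\<close>
    and as \<open>V\<close> at grid points.\<close>
  define V where "V n t = c n + step_int (Suc n) (p n) A (\<lambda>j. - F (p n j) (fst (E n j))) t" for n t
  define U where "U n t = step_int (Suc n) (p n) (\<lambda>x. x) (\<lambda>j. snd (E n j)) t" for n t
  have Up: "U n (p n j) = fst (E n j)" and Vp: "V n (p n j) = snd (E n j)" if "j \<le> Suc n" for n j
    using that p by (simp_all add: U_def V_def E_def step_int_at_node fst_euler[of _ _ _ _ j] snd_euler[of _ _ _ _ j])
  have Ua: "U n a = 0" and Ub: "U n b = 0" and Va: "V n a = c n" for n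
    using Up[of 0 n] Up[of "Suc n" n] Vp[of 0 n] c p by (auto simp: E_def simp del: euler.simps(2))
  have dV: "\<bar>V n t - V n s\<bar> \<le> M * (A t - A s)" if "a \<le> s" "s \<le> t" "t \<le> b" for n s t
  proof -
    have "\<bar>step_int (Suc n) (p n) A (\<lambda>j. - F (p n j) (fst (E n j))) t
      - step_int (Suc n) (p n) A (\<lambda>j. - F (p n j) (fst (E n j))) s - 0 * (A t - A s)\<bar> \<le> M * (A t - A s)"
      by (rule step_int_increment) (use p A that M pin in auto)
    then show ?thesis by (simp add: V_def)
  qed
  \<comment> \<open>One \<open>K\<close> bounds the initial slope and another the variation of
    \<open>V n\<close>.\<close>
  have Vb: "\<bar>V n t\<bar> \<le> 2 * K" if "t \<in> {a..b}" for n t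
  proof -
    have "\<bar>V n t - V n a\<bar> \<le> M * (A t - A a)" using dV[of a t] that by simp
    also have "\<dots> \<le> K" unfolding K_def using that ab M0
      by (intro mult_left_mono diff_right_mono mono_onD[OF A(1)]) auto
    finally show ?thesis using c(1)[of n] Va[of n] by linarith
  qed
  have dU: "\<bar>U n t - U n s\<bar> \<le> 2 * K * (t - s)" if "a \<le> s" "s \<le> t" "t \<le> b" for n s t
  proof -
    have "\<bar>step_int (Suc n) (p n) (\<lambda>x. x) (\<lambda>j. snd (E n j)) t
      - step_int (Suc n) (p n) (\<lambda>x. x) (\<lambda>j. snd (E n j)) s - 0 * (t - s)\<bar> \<le> 2 * K * (t - s)"
    proof (rule step_int_increment)
      fix j assume "j < Suc n"
      then show "\<bar>snd (E n j) - 0\<bar> \<le> 2 * K" using Vb[OF pin, of j n n] Vp[of j n] by simp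
    qed (use p that in \<open>auto simp: mono_on_def\<close>)
    then show ?thesis by (simp add: U_def)
  qed
  define R where "R = 2 * K * (b - a)"
  have Ubd: "\<bar>U n t\<bar> \<le> R" if "t \<in> {a..b}" for n t
  proof -
    have "\<bar>U n t - U n a\<bar> \<le> 2 * K * (t - a)" using dU[of a t] that by simp
    also have "\<dots> \<le> R" unfolding R_def using that K0 by (intro mult_left_mono) auto
    finally show ?thesis by (simp add: Ua)
  qed
  have dU': "\<bar>U n t - U n s\<bar> \<le> 2 * K * \<bar>t - s\<bar>" if "s \<in> {a..b}" "t \<in> {a..b}" for n s t
    using dU[of s t n] dU[of t s n] that by (cases "s \<le> t") auto
  have dV': "\<bar>V n t - V n s\<bar> \<le> M * \<bar>A t - A s\<bar>" if "s \<in> {a..b}" "t \<in> {a..b}" for n s t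
    using dV[of s t n] dV[of t s n] mono_onD[OF A(1), of s t] mono_onD[OF A(1), of t s] that
    by (cases "s \<le> t") auto
  \<comment> \<open>Arzela-Ascoli is applied to the pairs, so that a single subsequence serves both
    components. \<open>U\<close> is equi-Lipschitz, and \<open>V\<close> inherits the modulus of
    continuity of \<open>A\<close>.\<close>
  obtain h k where hk: "continuous_on {a..b} h" "strict_mono (k :: nat \<Rightarrow> nat)"
    "\<And>e. 0 < e \<Longrightarrow> \<exists>N. \<forall>n x. n \<ge> N \<and> x \<in> {a..b} \<longrightarrow> norm ((U (k n) x, V (k n) x) - h x) < e"
  proof (rule Arzela_Ascoli[of "{a..b}" "\<lambda>n x. (U n x, V n x)" "R + 2 * K"])
    show "norm (U n x, V n x) \<le> R + 2 * K" if "x \<in> {a..b}" for n x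
      using norm_Pair_le[of "U n x" "V n x"] Ubd[OF that, of n] Vb[OF that, of n] by simp
    fix x e :: real assume x: "x \<in> {a..b}" and e: "0 < e"
    \<comment> \<open>Half of \<open>e\<close> goes to each component; adding 1 in the denominators
      covers \<open>M = 0\<close> and \<open>K = 0\<close>.\<close>
    define e1 where "e1 = e / 2 / (M + 1)"
    define e2 where "e2 = e / 2 / (2 * K + 1)"
    have e12: "e1 > 0" "e2 > 0" "M * e1 < e / 2" "2 * K * e2 < e / 2"
      using e M0 K0 by (auto simp: e1_def e2_def field_simps)
    obtain d where d: "d > 0" "\<And>y. y \<in> {a..b} \<Longrightarrow> \<bar>y - x\<bar> < d \<Longrightarrow> \<bar>A y - A x\<bar> < e1"
      using A(2) x e12(1) unfolding continuous_on_iff dist_real_def by metis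
    show "\<exists>d>0. \<forall>n y. y \<in> {a..b} \<and> norm (x - y) < d \<longrightarrow> norm ((U n x, V n x) - (U n y, V n y)) < e"
    proof (intro exI conjI allI impI)
      show "min d e2 > 0" using d e12 by simp
      fix n y assume y: "y \<in> {a..b} \<and> norm (x - y) < min d e2"
      have "\<bar>U n x - U n y\<bar> \<le> 2 * K * \<bar>x - y\<bar>" using dU' x y by simp
      also have "\<dots> \<le> 2 * K * e2" using y K0 by (intro mult_left_mono) auto
      finally have 1: "\<bar>U n x - U n y\<bar> < e / 2" using e12 by simp
      have "\<bar>V n x - V n y\<bar> \<le> M * \<bar>A x - A y\<bar>" using dV' x y by simp
      also have "\<dots> \<le> M * e1" using y d(2)[of y] M0 by (intro mult_left_mono) (auto simp: abs_minus_commute[of x] abs_minus_commute[of "A x"])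
      finally have "\<bar>V n x - V n y\<bar> < e / 2" using e12 by simp
      with 1 show "norm ((U n x, V n x) - (U n y, V n y)) < e"
        using norm_Pair_le[of "U n x - U n y" "V n x - V n y"] by simp
    qed
  qed auto
  define u where "u = (\<lambda>t. fst (h t))"
  define v where "v = (\<lambda>t. snd (h t))"
  have cu: "continuous_on {a..b} u" and cv: "continuous_on {a..b} v"
    unfolding u_def v_def using hk(1) by (auto intro: continuous_intros)
  have ul: "uniform_limit {a..b} (\<lambda>n x. (U (k n) x, V (k n) x)) h sequentially"
    unfolding uniform_limit_sequentially_iff dist_norm using hk(3) by meson
  have ulU: "uniform_limit {a..b} (\<lambda>n. U (k n)) u sequentially"
    and ulV: "uniform_limit {a..b} (\<lambda>n. V (k n)) v sequentially"
    using bounded_linear.uniform_limit[OF bounded_linear_fst ul]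
      bounded_linear.uniform_limit[OF bounded_linear_snd ul] by (simp_all add: u_def v_def)
  have limU: "(\<lambda>n. U (k n) t) \<longlonglongrightarrow> u t" and limV: "(\<lambda>n. V (k n) t) \<longlonglongrightarrow> v t" if "t \<in> {a..b}" for t
    using tendsto_uniform_limitI[OF ulU that] tendsto_uniform_limitI[OF ulV that] .
  have k: "filterlim (\<lambda>n. Suc (k n)) at_top sequentially"
    by (intro filterlim_compose[OF filterlim_Suc filterlim_subseq[OF hk(2)]])
  \<comment> \<open>All graphs of \<open>U n\<close> lie in the compact rectangle
    \<open>{a..b} \<times> {-R..R}\<close>, on which \<open>F\<close> is uniformly continuous, so
    uniform convergence passes through \<open>F\<close>.\<close>
  have "uniform_limit {a..b} (\<lambda>n x. case (x, U (k n) x) of (t, x) \<Rightarrow> F t x) (\<lambda>x. case (x, u x) of (t, x) \<Rightarrow> F t x) sequentially"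
  proof (rule uniform_limit_compose_uniformly_continuous_on[where f = "\<lambda>(t, x). F t x"])
    show "uniform_limit {a..b} (\<lambda>n x. (x, U (k n) x)) (\<lambda>x. (x, u x)) sequentially"
      using ulU by (simp add: uniform_limit_iff dist_Pair_Pair)
    show "uniformly_continuous_on ({a..b} \<times> {-R..R}) (\<lambda>(t, x). F t x)"
      by (intro compact_uniformly_continuous compact_Times continuous_on_subset[OF F]) auto
    show "\<forall>\<^sub>F n in sequentially. \<forall>x\<in>{a..b}. (x, U (k n) x) \<in> {a..b} \<times> {-R..R}"
      using Ubd by (simp add: abs_le_iff minus_le_iff)
  qed (auto intro: closed_Times)
  then have ulF: "uniform_limit {a..b} (\<lambda>n x. - F x (U (k n) x)) (\<lambda>x. - F x (u x)) sequentially"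
    by (simp add: uniform_limit_iff dist_minus)
  have "continuous_on {a..b} (\<lambda>x. - F x (u x))"
  proof -
    have "continuous_on {a..b} (\<lambda>x. case (x, u x) of (t, x) \<Rightarrow> F t x)"
      by (rule continuous_on_compose2[OF F]) (use cu in \<open>auto intro!: continuous_intros\<close>)
    then show ?thesis by (auto intro: continuous_intros)
  qed
  \<comment> \<open>The limit lemma is used twice: with integrator \<open>A\<close> and integrand
    \<open>- F\<close> along \<open>U\<close>, and with the identity as integrator and integrand
    \<open>V\<close>.\<close>
  note dv = step_int_limit_has_derivative[OF ab k _ A(1) ulF this, of "\<lambda>n. c (k n)" v]
    and du = step_int_limit_has_derivative[OF ab k _ _ ulV cv, of "\<lambda>x. x" "\<lambda>_. 0" u]
  show thesis
  proof (rule that)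
    show "u a = 0" "u b = 0"
      using LIMSEQ_unique[OF limU[of a]] LIMSEQ_unique[OF limU[of b]] ab by (auto simp: Ua Ub)
    show "continuous_on {a..b} v" by fact
    show "(u has_real_derivative v t) (at t within {a..b})" if t: "t \<in> {a..b}" for t
    proof -
      have "step_int (Suc n) (p n) (\<lambda>x. x) (\<lambda>j. V n (p n j)) x = U n x" for n x
        unfolding U_def step_int_def by (intro sum.cong) (auto simp: Vp)
      then show ?thesis
        using du[of t 1] t limU by (simp add: mono_on_def p_def)
    qed
    show "(v has_real_derivative - F t (u t) * D) (at t within {a..b})"
      if t: "t \<in> {a..b}" "(A has_real_derivative D) (at t within {a..b})" for t D
    proof -
      have "c n + step_int (Suc n) (p n) A (\<lambda>j. - F (p n j) (U n (p n j))) x = V n x" for n x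
        unfolding V_def step_int_def by (intro arg_cong2[of _ _ _ _ "(+)"] sum.cong) (auto simp: Up)
      then show ?thesis
        using dv[of t D] t limV by (simp add: p_def)
    qed
    show "\<bar>v t - v s\<bar> \<le> M * (A t - A s)" if "a \<le> s" "s \<le> t" "t \<le> b" for s t
    proof (rule tendsto_upperbound)
      show "(\<lambda>n. \<bar>V (k n) t - V (k n) s\<bar>) \<longlonglongrightarrow> \<bar>v t - v s\<bar>"
        using that by (intro tendsto_intros limV) auto
      show "\<forall>\<^sub>F n in sequentially. \<bar>V (k n) t - V (k n) s\<bar> \<le> M * (A t - A s)"
        using dV[OF that] by simp
    qed simp
  qed
qed

section \<open>Comparison with lower and upper solutions\<close>

lemma sum_mono_increments_le:
  fixes A :: "real \<Rightarrow> real" and n :: nat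
  assumes A: "mono_on {a..b} A" and ab: "a \<le> b"
    and xy: "\<And>i. i < n \<Longrightarrow> a \<le> x i \<and> x i \<le> y i \<and> y i \<le> b"
    and disj: "\<And>i j. i < n \<Longrightarrow> j < n \<Longrightarrow> i \<noteq> j \<Longrightarrow> y i \<le> x j \<or> y j \<le> x i"
  shows "(\<Sum>i<n. A (y i) - A (x i)) \<le> A b - A a"
proof -
  have le: "A s \<le> A t" if "a \<le> s" "s \<le> t" "t \<le> b" for s t using mono_onD[OF A] that by auto
  let ?I = "\<lambda>i. {A (x i)<..<A (y i)}"
  \<comment> \<open>The increments are lengths of pairwise disjoint open intervals inside
    \<open>{A a..A b}\<close>; additivity of Lebesgue measure avoids sorting them.\<close>
  have "(\<Sum>i<n. A (y i) - A (x i)) = (\<Sum>i<n. measure lborel (?I i))"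
    using xy le by (intro sum.cong) auto
  also have "\<dots> = measure lborel (\<Union>i<n. ?I i)"
  proof (rule measure_finite_Union[symmetric])
    show "disjoint_family_on ?I {..<n}"
      unfolding disjoint_family_on_def
    proof (intro ballI impI)
      fix i j assume ij: "i \<in> {..<n}" "j \<in> {..<n}" "i \<noteq> j"
      then have "y i \<le> x j \<or> y j \<le> x i" using disj by simp
      then have "A (y i) \<le> A (x j) \<or> A (y j) \<le> A (x i)"
        using le[of "y i" "x j"] le[of "y j" "x i"] xy[of i] xy[of j] ij by auto
      then show "?I i \<inter> ?I j = {}" by auto
    qed
    show "emeasure lborel (?I i) \<noteq> \<infinity>" if "i \<in> {..<n}" for i
      using that xy[of i] le by simp
  qed auto
  also have "\<dots> \<le> measure lborel {A a..A b}"
  proof (rule measure_mono_fmeasurable)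
    show "(\<Union>i<n. ?I i) \<subseteq> {A a..A b}"
    proof
      fix z assume "z \<in> (\<Union>i<n. ?I i)"
      then obtain i where "i < n" "A (x i) < z" "z < A (y i)" by auto
      moreover from this have "A a \<le> A (x i)" "A (y i) \<le> A b" using xy[of i] ab by (auto intro!: le)
      ultimately show "z \<in> {A a..A b}" by auto
    qed
  qed (use le[of a b] ab in \<open>auto simp: fmeasurable_def\<close>)
  also have "\<dots> = A b - A a" using le ab by simp
  finally show ?thesis .
qed

text \<open>The power is continuous at \<open>a\<close> and Lipschitz away from \<open>a\<close>.
  Cut at a point \<open>c\<close> so close to \<open>a\<close> that the total increment of the power
  over \<open>{a..c}\<close> is already small; beyond \<open>c\<close> the Lipschitz bound controls
  the sum by the total length.\<close>

lemma abs_cont_on_if_powr_increments: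
  fixes a b \<beta> :: real
  assumes ab: "a < b" and \<beta>: "0 < \<beta>" "\<beta> < 1"
    and v: "\<And>s t. a \<le> s \<Longrightarrow> s \<le> t \<Longrightarrow> t \<le> b \<Longrightarrow> \<bar>v t - v s\<bar> \<le> M * ((t - a) powr \<beta> - (s - a) powr \<beta>)"
  shows "abs_cont_on a b v"
  unfolding abs_cont_on_def
proof (intro allI impI)
  fix e :: real assume e: "e > 0"
  define A where "A t = (t - a) powr \<beta>" for t
  have Ale: "A s \<le> A t" if "a \<le> s" "s \<le> t" for s t
    unfolding A_def using that \<beta> by (intro powr_mono2) auto
  have contA: "continuous_on {a..} A"
    unfolding A_def using \<beta> by (intro continuous_on_powr' continuous_intros) auto
  have M0: "0 \<le> M"
  proof -
    have "0 \<le> M * (b - a) powr \<beta>" using v[of a b] ab \<beta> by simp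
    then show ?thesis using ab by (simp add: zero_le_mult_iff)
  qed
  obtain c where c: "a < c" "c \<le> b" "M * (A c - A a) < e / 2"
  proof -
    have "((\<lambda>t. M * (A t - A a)) \<longlongrightarrow> M * (A a - A a)) (at a within {a..})"
      using contA by (intro tendsto_intros) (auto simp: continuous_on_def)
    then have "\<forall>\<^sub>F t in at a within {a..}. M * (A t - A a) < e / 2"
      by (rule order_tendstoD) (use e in simp)
    then obtain d where d: "d > 0" "\<And>t. t \<ge> a \<Longrightarrow> t \<noteq> a \<Longrightarrow> \<bar>t - a\<bar> < d \<Longrightarrow> M * (A t - A a) < e / 2"
      unfolding eventually_at dist_real_def by auto
    show thesis
      by (rule that[of "min b (a + d / 2)"]) (use d ab in auto)
  qed
  \<comment> \<open>The derivative of the power decreases because \<open>\<beta> < 1\<close>, so its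
    value at \<open>c\<close> is a Lipschitz constant on the right of \<open>c\<close>.\<close>
  define L where "L = \<beta> * (c - a) powr (\<beta> - 1)"
  have L: "A t - A s \<le> L * (t - s)" if st: "c \<le> s" "s \<le> t" for s t
  proof (cases "s = t")
    case False
    have "\<exists>z. z > s \<and> z < t \<and> A t - A s = (t - s) * (\<beta> * (z - a) powr (\<beta> - 1))"
    proof (rule MVT2)
      show "s < t" using False st by simp
      show "(A has_real_derivative \<beta> * (z - a) powr (\<beta> - 1)) (at z)" if "s \<le> z" "z \<le> t" for z
        unfolding A_def using that st c \<beta> by (auto intro!: derivative_eq_intros)
    qed
    then obtain z where z: "z > s" "A t - A s = (t - s) * (\<beta> * (z - a) powr (\<beta> - 1))" by blast
    have "(z - a) powr (\<beta> - 1) \<le> (c - a) powr (\<beta> - 1)"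
      using z st c \<beta> by (intro powr_mono2') auto
    then show ?thesis using z st \<beta> unfolding L_def
      by (simp add: mult.commute mult_left_mono)
  qed simp
  have L0: "L \<ge> 0" using \<beta> by (simp add: L_def)
  define d where "d = e / 2 / (M * L + 1)"
  have LM: "M * L \<ge> 0" using M0 L0 by simp
  have d: "d > 0" "M * L * d < e / 2" using LM e by (auto simp: d_def field_simps)
  show "\<exists>d>0. \<forall>(n::nat) x y. (\<forall>i<n. a \<le> x i \<and> x i \<le> y i \<and> y i \<le> b) \<and>
        (\<forall>i<n. \<forall>j<n. i \<noteq> j \<longrightarrow> y i \<le> x j \<or> y j \<le> x i) \<and> (\<Sum>i<n. y i - x i) < d \<longrightarrow>
        (\<Sum>i<n. \<bar>v (y i) - v (x i)\<bar>) < e"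
  proof (intro exI[of _ d] conjI d(1) allI impI; elim conjE)
    fix n :: nat and x y :: "nat \<Rightarrow> real"
    assume xy: "\<forall>i<n. a \<le> x i \<and> x i \<le> y i \<and> y i \<le> b"
      and disj: "\<forall>i<n. \<forall>j<n. i \<noteq> j \<longrightarrow> y i \<le> x j \<or> y j \<le> x i"
      and len: "(\<Sum>i<n. y i - x i) < d"
    \<comment> \<open>Clamping by \<open>min c\<close> keeps the intervals non-overlapping and moves
      them into \<open>{a..c}\<close>, where they cannot use up more than
      \<open>A c - A a\<close>.\<close>
    have inc: "(\<Sum>i<n. A (min c (y i)) - A (min c (x i))) \<le> A c - A a"
    proof (rule sum_mono_increments_le[where A = A])
      show "mono_on {a..c} A" using Ale by (auto simp: mono_on_def)
      show "a \<le> min c (x i) \<and> min c (x i) \<le> min c (y i) \<and> min c (y i) \<le> c" if "i < n" for i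
        using xy that c by auto
      show "min c (y i) \<le> min c (x j) \<or> min c (y j) \<le> min c (x i)" if "i < n" "j < n" "i \<noteq> j" for i j
        using disj that by (meson min.mono order_refl)
    qed (use c in simp)
    have "(\<Sum>i<n. \<bar>v (y i) - v (x i)\<bar>) \<le>
      (\<Sum>i<n. M * (A (min c (y i)) - A (min c (x i))) + M * L * (y i - x i))"
    proof (rule sum_mono)
      fix i assume "i \<in> {..<n}"
      then have i: "a \<le> x i" "x i \<le> y i" "y i \<le> b" using xy by auto
      \<comment> \<open>For every \<open>r\<close>,
        \<open>A (min c r) + A (max c r) = A c + A r\<close>; this splits each increment at
        \<open>c\<close> wherever the interval lies.\<close>
      have "A (y i) - A (x i) = (A (min c (y i)) - A (min c (x i))) + (A (max c (y i)) - A (max c (x i)))"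
        by (auto simp: min_def max_def)
      also have "A (max c (y i)) - A (max c (x i)) \<le> L * (max c (y i) - max c (x i))"
        using i by (intro L) auto
      also have "\<dots> \<le> L * (y i - x i)" using i L0 by (intro mult_left_mono) auto
      finally have "M * (A (y i) - A (x i)) \<le> M * (A (min c (y i)) - A (min c (x i)) + L * (y i - x i))"
        using M0 by (intro mult_left_mono) auto
      then show "\<bar>v (y i) - v (x i)\<bar> \<le> M * (A (min c (y i)) - A (min c (x i))) + M * L * (y i - x i)"
        using v[OF i] unfolding A_def[symmetric] by (simp add: algebra_simps)
    qed
    also have "\<dots> = M * (\<Sum>i<n. A (min c (y i)) - A (min c (x i))) + M * L * (\<Sum>i<n. y i - x i)"
      by (simp add: sum.distrib sum_distrib_left)
    also have "\<dots> \<le> M * (A c - A a) + M * L * d"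
      using inc len M0 LM by (intro add_mono mult_left_mono) auto
    finally show "(\<Sum>i<n. \<bar>v (y i) - v (x i)\<bar>) < e"
      using c d by simp
  qed
qed

section \<open>Conformable derivatives and a maximum principle\<close>

lemma conf_has_deriv_DERIV:
  assumes "a < t" "(h has_real_derivative D) (at t)"
  shows "conf_has_deriv \<beta> a h t ((t - a) powr (1 - \<beta>) * D)"
proof -
  define k where "k = (t - a) powr (1 - \<beta>)"
  \<comment> \<open>The conformable quotient is the ordinary difference quotient at 0 of this
    composition, so the chain rule evaluates it.\<close>
  have "((\<lambda>x. h (t + x * k)) has_real_derivative D * k) (at 0)"
    using assms(2) by (auto intro!: derivative_eq_intros DERIV_chain2[of h D])
  then show ?thesis
    by (simp add: conf_has_deriv_def DERIV_def k_def mult.commute)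
qed

lemma conf_has_deriv_unique:
  "conf_has_deriv \<beta> a h t L \<Longrightarrow> conf_has_deriv \<beta> a h t L' \<Longrightarrow> L = L'"
  unfolding conf_has_deriv_def by (rule tendsto_unique[rotated]) auto

text \<open>At the maximum \<open>z'\<close> vanishes; if \<open>D\<close> were positive,
  \<open>z'\<close> would be positive just to the right of \<open>t\<close>, and the mean value
  theorem would give a larger value of \<open>z\<close> there.\<close>

lemma no_interior_max:
  fixes z z' :: "real \<Rightarrow> real"
  assumes t: "a < t" "t < b" and max: "\<And>s. a < s \<Longrightarrow> s < b \<Longrightarrow> z s \<le> z t"
    and z: "\<And>s. a < s \<Longrightarrow> s < b \<Longrightarrow> (z has_real_derivative z' s) (at s)"
    and z2: "(z' has_real_derivative D) (at t)"
  shows "D \<le> 0"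
proof (rule ccontr)
  assume "\<not> D \<le> 0"
  have "z' t = 0"
    by (rule DERIV_local_max[OF z[OF t], of "min (t - a) (b - t)"]) (use t max in auto)
  with z2 \<open>\<not> D \<le> 0\<close> obtain d where d: "d > 0" "\<And>h. 0 < h \<Longrightarrow> h < d \<Longrightarrow> z' (t + h) > 0"
    using DERIV_pos_inc_right[OF z2] by auto
  define s where "s = t + min d (b - t) / 2"
  have s: "t < s" "s < b" "s - t < d" using d t by (auto simp: s_def min_def field_simps)
  have "\<exists>x>t. x < s \<and> z s - z t = (s - t) * z' x"
    by (rule MVT2) (use s t z in auto)
  then obtain x where x: "t < x" "x < s" "z s - z t = (s - t) * z' x" by blast
  have "z' x > 0" using d(2)[of "x - t"] x s by simp
  then have "z s > z t" using x s by (metis diff_gt_0_iff_gt mult_pos_pos)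
  then show False using max[of s] s t by simp
qed

lemma continuous_on_AC2:
  assumes "AC2 a b s" "a < b"
  shows "continuous_on {a..b} s"
  using assms unfolding AC2_def by (meson DERIV_continuous_on)

lemma twice_diff_on_D:
  assumes "twice_diff_on {a<..<b} s" "a < t" "t < b"
  shows "(s has_real_derivative deriv s t) (at t)"
    and "(deriv s has_real_derivative deriv (deriv s) t) (at t)"
  using assms unfolding twice_diff_on_def
  by (auto simp: DERIV_deriv_iff_real_differentiable)

lemma twice_diff_onI:
  assumes "\<And>t. a < t \<Longrightarrow> t < b \<Longrightarrow> (s has_real_derivative v t) (at t)"
    and "\<And>t. a < t \<Longrightarrow> t < b \<Longrightarrow> (deriv s has_real_derivative w t) (at t)"
  shows "twice_diff_on {a<..<b} s"
  unfolding twice_diff_on_def real_differentiable_def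
  using assms by (meson greaterThanLessThan_iff)

text \<open>A positive maximum of \<open>u - s\<close> would be interior by the endpoint
  inequalities, and there the strict inequality between the second derivatives contradicts the
  second-order condition.\<close>

lemma comparison:
  fixes u v s :: "real \<Rightarrow> real"
  assumes ab: "a < b" and uc: "continuous_on {a..b} u" and sc: "continuous_on {a..b} s"
    and end_le: "u a \<le> s a" "u b \<le> s b"
    and s: "twice_diff_on {a<..<b} s"
    and u: "\<And>t. a < t \<Longrightarrow> t < b \<Longrightarrow> (u has_real_derivative v t) (at t)"
    and v: "\<And>t. a < t \<Longrightarrow> t < b \<Longrightarrow> (v has_real_derivative w t) (at t)"
    and gt: "\<And>t. a < t \<Longrightarrow> t < b \<Longrightarrow> s t < u t \<Longrightarrow> deriv (deriv s) t < w t"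
    and t: "t \<in> {a..b}"
  shows "u t \<le> s t"
proof -
  obtain m where m: "m \<in> {a..b}" "\<And>x. x \<in> {a..b} \<Longrightarrow> u x - s x \<le> u m - s m"
    using continuous_attains_sup[of "{a..b}" "\<lambda>x. u x - s x"] continuous_on_diff[OF uc sc] ab by auto
  have "u m \<le> s m"
  proof (rule ccontr)
    assume pos: "\<not> u m \<le> s m"
    then have m': "a < m" "m < b" using m end_le by (auto simp: less_le)
    have "w m - deriv (deriv s) m \<le> 0"
    proof (rule no_interior_max[OF m', of "\<lambda>x. u x - s x"])
      show "((\<lambda>x. u x - s x) has_real_derivative v x - deriv s x) (at x)" if "a < x" "x < b" for x
        using that by (intro DERIV_diff u twice_diff_on_D[OF s])
      show "((\<lambda>x. v x - deriv s x) has_real_derivative w m - deriv (deriv s) m) (at m)"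
        using m' by (intro DERIV_diff v twice_diff_on_D[OF s])
    qed (use m in auto)
    then show False using gt[OF m'] pos by simp
  qed
  then show ?thesis using m(2)[OF t] by simp
qed

section \<open>Truncation of the nonlinearity and location of the solution in the strip\<close>

theorem theorem1:
  fixes \<alpha> a b :: real and f :: "real \<Rightarrow> real \<Rightarrow> real" and sl su :: "real \<Rightarrow> real"
  assumes "1 < \<alpha>" "\<alpha> < 2" "a < b"
    and "lower_sol \<alpha> a b f sl" and "upper_sol \<alpha> a b f su"
    and "\<forall>t\<in>{a..b}. sl t \<le> su t"
    and "continuous_on {(t, x). t \<in> {a..b} \<and> sl t \<le> x \<and> x \<le> su t} (\<lambda>(t, x). f t x)"
  shows "\<exists>u. AC2 a b u \<and> twice_diff_on {a<..<b} u \<and> is_sol \<alpha> a b f u \<and>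
             (\<forall>t\<in>{a..b}. sl t \<le> u t \<and> u t \<le> su t)"
proof -
  note \<alpha> = assms(1,2) and ab = assms(3) and le = assms(6)[rule_format] and f = assms(7)
  have lo: "twice_diff_on {a<..<b} sl" "sl a \<le> 0" "sl b \<le> 0"
    and up: "twice_diff_on {a<..<b} su" "su a \<ge> 0" "su b \<ge> 0"
    using assms(4,5) by (auto simp: lower_sol_def upper_sol_def)
  have cont: "continuous_on {a..b} sl" "continuous_on {a..b} su"
    using assms(3-5) by (auto simp: lower_sol_def upper_sol_def intro: continuous_on_AC2)
  \<comment> \<open>\<open>w\<close> is the reciprocal of the factor
    \<open>(t - a) powr (2 - \<alpha>)\<close> in the conformable derivative; multiplying by
    \<open>w\<close> turns each inequality into one for the ordinary second derivative.\<close>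
  define w where "w t = (t - a) powr (\<alpha> - 2)" for t
  have w: "w t > 0" "(t - a) powr (1 - (\<alpha> - 1)) * w t = 1" if "a < t" for t
    using that by (auto simp: w_def simp flip: powr_add)
  have equation: "L = (t - a) powr (1 - (\<alpha> - 1)) * deriv (deriv s) t"
    if "conf_has_deriv2 \<alpha> a s t L" "twice_diff_on {a<..<b} s" "a < t" "t < b" for s t L
    using conf_has_deriv_unique[OF that(1)[unfolded conf_has_deriv2_def]]
      conf_has_deriv_DERIV[OF that(3) twice_diff_on_D(2)[OF that(2-4)]] by blast
  have scale: "w t * ((t - a) powr (1 - (\<alpha> - 1)) * x) = x" if "a < t" for t x
    using w(2)[OF that] by (simp add: algebra_simps)
  have lo2: "deriv (deriv sl) t + w t * f t (sl t) \<ge> 0" if t: "a < t" "t < b" for t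
  proof -
    obtain L where L: "conf_has_deriv2 \<alpha> a sl t L" "L + f t (sl t) \<ge> 0"
      using assms(4) t unfolding lower_sol_def by (meson greaterThanLessThan_iff)
    have "0 \<le> w t * (L + f t (sl t))" using L w(1)[OF t(1)] by simp
    also have "\<dots> = deriv (deriv sl) t + w t * f t (sl t)"
      using equation[OF L(1) lo(1) t] scale[OF t(1)] by (simp add: ring_distribs)
    finally show ?thesis .
  qed
  have up2: "deriv (deriv su) t + w t * f t (su t) \<le> 0" if t: "a < t" "t < b" for t
  proof -
    obtain L where L: "conf_has_deriv2 \<alpha> a su t L" "L + f t (su t) \<le> 0"
      using assms(5) t unfolding upper_sol_def by (meson greaterThanLessThan_iff)
    have "deriv (deriv su) t + w t * f t (su t) = w t * (L + f t (su t))"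
      using equation[OF L(1) up(1) t] scale[OF t(1)] by (simp add: ring_distribs)
    also have "\<dots> \<le> 0" using L w(1)[OF t(1)] by (simp add: mult_nonneg_nonpos)
    finally show ?thesis .
  qed

  \<comment> \<open>\<open>p\<close> projects onto the strip. The penalty in \<open>F\<close> is cut
    off at 1 in absolute value, so that \<open>F\<close> stays bounded, yet it is nonzero strictly
    outside the strip, which makes the comparison strict.\<close>
  define p where "p t x = max (sl t) (min (su t) x)" for t x
  define F where "F t x = f t (p t x) - max (-1) (min 1 (x - p t x))" for t x
  have fst_cont: "continuous_on ({a..b} \<times> UNIV) (\<lambda>z. sl (fst z))" "continuous_on ({a..b} \<times> UNIV) (\<lambda>z. su (fst z))"
    using cont by (auto intro!: continuous_on_compose2[of "{a..b}" _ _ fst] continuous_intros)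
  have contp: "continuous_on ({a..b} \<times> UNIV) (\<lambda>(t, x). p t x)"
    unfolding p_def split_beta by (intro continuous_intros fst_cont)
  have pE: "sl t \<le> p t x" "p t x \<le> su t" if "t \<in> {a..b}" for t x
    using le[OF that] by (auto simp: p_def)
  have contfp: "continuous_on ({a..b} \<times> UNIV) (\<lambda>(t, x). f t (p t x))"
  proof -
    have "continuous_on ({a..b} \<times> UNIV) (\<lambda>z. case (fst z, p (fst z) (snd z)) of (t, x) \<Rightarrow> f t x)"
      by (rule continuous_on_compose2[OF f])
        (use contp pE in \<open>auto simp: split_beta intro!: continuous_intros\<close>)
    then show ?thesis by (simp add: split_beta)
  qed
  have contF: "continuous_on ({a..b} \<times> UNIV) (\<lambda>(t, x). F t x)"
    unfolding F_def using contp contfp by (auto simp: split_beta intro!: continuous_intros)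
  obtain M where M: "\<And>t x. t \<in> {a..b} \<Longrightarrow> \<bar>F t x\<bar> \<le> M"
  proof -
    \<comment> \<open>As \<open>p t\<close> is idempotent, every value \<open>f t (p t x)\<close> is
      already taken with second argument between \<open>c1\<close> and \<open>c2\<close>, so
      compactness of a rectangle bounds it.\<close>
    obtain c1 where c1: "\<And>t. t \<in> {a..b} \<Longrightarrow> c1 \<le> sl t"
      using continuous_attains_inf[OF compact_Icc _ cont(1)] ab
      by (metis atLeastAtMost_iff empty_iff less_imp_le order_refl)
    obtain c2 where c2: "\<And>t. t \<in> {a..b} \<Longrightarrow> su t \<le> c2"
      using continuous_attains_sup[OF compact_Icc _ cont(2)] ab
      by (metis atLeastAtMost_iff empty_iff less_imp_le order_refl)
    have "compact ((\<lambda>(t, x). f t (p t x)) ` ({a..b} \<times> {c1..c2}))"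
      by (intro compact_continuous_image compact_Times continuous_on_subset[OF contfp]) auto
    then obtain B where B: "\<And>y. y \<in> (\<lambda>(t, x). f t (p t x)) ` ({a..b} \<times> {c1..c2}) \<Longrightarrow> norm y \<le> B"
      using compact_imp_bounded bounded_iff by metis
    show thesis
    proof (rule that)
      fix t x assume t: "t \<in> {a..b}"
      have "p t (p t x) = p t x" using pE[OF t, of x] by (simp add: p_def[of t "p t x"])
      then have "f t (p t x) = (\<lambda>(t, x). f t (p t x)) (t, p t x)" by simp
      moreover have "(t, p t x) \<in> {a..b} \<times> {c1..c2}"
        using t c1[OF t] c2[OF t] pE[OF t, of x] by auto
      ultimately have "f t (p t x) \<in> (\<lambda>(t, x). f t (p t x)) ` ({a..b} \<times> {c1..c2})"
        by (rule image_eqI)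
      from B[OF this] have "\<bar>f t (p t x)\<bar> \<le> B" by simp
      then show "\<bar>F t x\<bar> \<le> B + 1" unfolding F_def by linarith
    qed
  qed

  \<comment> \<open>An antiderivative of \<open>w\<close> on the right of \<open>a\<close>. The
    exponent \<open>\<alpha> - 1\<close> is positive, so \<open>A\<close> is continuous at
    \<open>a\<close> with \<open>A a = 0\<close>.\<close>
  define A where "A t = (t - a) powr (\<alpha> - 1) / (\<alpha> - 1)" for t
  have A1: "mono_on {a..b} A"
    unfolding A_def mono_on_def using \<alpha> by (auto intro!: divide_right_mono powr_mono2)
  have A2: "continuous_on {a..b} A"
    unfolding A_def using \<alpha> by (intro continuous_intros continuous_on_powr') auto
  have A3: "(A has_real_derivative w t) (at t)" if "a < t" for t
    unfolding A_def w_def using that \<alpha> by (auto intro!: derivative_eq_intros)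

  obtain u v where uv: "u a = 0" "u b = 0" "continuous_on {a..b} v"
    and du: "\<And>t. t \<in> {a..b} \<Longrightarrow> (u has_real_derivative v t) (at t within {a..b})"
    and vM: "\<And>s t. a \<le> s \<Longrightarrow> s \<le> t \<Longrightarrow> t \<le> b \<Longrightarrow> \<bar>v t - v s\<bar> \<le> M * (A t - A s)"
    and dv: "\<And>t D. t \<in> {a..b} \<Longrightarrow> (A has_real_derivative D) (at t within {a..b}) \<Longrightarrow>
      (v has_real_derivative - F t (u t) * D) (at t within {a..b})"
    using dirichlet_solution[OF ab A1 A2 contF M] by metis
  have at_in: "at t within {a..b} = at t" if "a < t" "t < b" for t
    using that by (intro at_within_interior) (simp add: interior_atLeastAtMost_real)
  have du': "(u has_real_derivative v t) (at t)" if "a < t" "t < b" for t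
    using du[of t] that at_in by simp
  have dv': "(v has_real_derivative - F t (u t) * w t) (at t)" if "a < t" "t < b" for t
    using dv[of t "w t"] that at_in A3 by simp
  have deriv_u: "deriv u t = v t" if "a < t" "t < b" for t
    using du'[OF that] by (rule DERIV_imp_deriv)
  \<comment> \<open>\<open>deriv u\<close> is known to equal \<open>v\<close> only inside the
    interval, so the derivative of \<open>v\<close> is transferred on the open set
    \<open>{a<..<b}\<close>.\<close>
  have ddu: "(deriv u has_real_derivative - F t (u t) * w t) (at t)" if "a < t" "t < b" for t
    by (rule has_field_derivative_transform_within_open[OF dv'[OF that], of "{a<..<b}"])
      (use that deriv_u in auto)
  have td: "twice_diff_on {a<..<b} u"
    using du' ddu by (rule twice_diff_onI)
  have uc: "continuous_on {a..b} u" using du by (rule DERIV_continuous_on)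
  have "abs_cont_on a b v"
  proof (rule abs_cont_on_if_powr_increments[OF ab])
    show "\<bar>v t - v s\<bar> \<le> M / (\<alpha> - 1) * ((t - a) powr (\<alpha> - 1) - (s - a) powr (\<alpha> - 1))"
      if "a \<le> s" "s \<le> t" "t \<le> b" for s t
      using vM[OF that] by (simp add: A_def diff_divide_distrib right_diff_distrib)
  qed (use \<alpha> in auto)
  then have AC: "AC2 a b u" unfolding AC2_def using du uv(3) by blast
  have le_su: "u t \<le> su t" if "t \<in> {a..b}" for t
  proof (rule comparison[OF ab uc cont(2) _ _ up(1) du' dv' _ that])
    \<comment> \<open>Above \<open>su\<close> the penalty is positive, so
      \<open>F t (u t) < f t (su t)\<close>; hence the second derivative of \<open>u\<close> exceeds
      \<open>- w t * f t (su t)\<close>, which is at least that of \<open>su\<close>.\<close>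
    fix t assume t: "a < t" "t < b" "su t < u t"
    then have "p t (u t) = su t" using le[of t] by (simp add: p_def)
    then have "F t (u t) < f t (su t)" using t by (simp add: F_def)
    then have "w t * F t (u t) < w t * f t (su t)" using w(1) t by simp
    then show "deriv (deriv su) t < - F t (u t) * w t" using up2[OF t(1,2)] by (simp add: mult.commute)
  qed (use uv up in auto)
  have le_sl: "sl t \<le> u t" if "t \<in> {a..b}" for t
  proof -
    \<comment> \<open>The lower bound is the upper one reflected: below \<open>sl\<close> the
      penalty is negative, and \<open>comparison\<close> is applied to \<open>- u\<close> and
      \<open>- sl\<close>.\<close>
    have "- u t \<le> - sl t"
    proof (rule comparison[OF ab _ _ _ _ _ DERIV_minus[OF du'] DERIV_minus[OF dv'] _ that])
      have d: "deriv (\<lambda>x. - sl x) t = - deriv sl t" if "a < t" "t < b" for t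
        by (rule DERIV_imp_deriv[OF DERIV_minus[OF twice_diff_on_D(1)[OF lo(1) that]]])
      have dd: "(deriv (\<lambda>x. - sl x) has_real_derivative - deriv (deriv sl) t) (at t)" if "a < t" "t < b" for t
        by (rule has_field_derivative_transform_within_open[OF
              DERIV_minus[OF twice_diff_on_D(2)[OF lo(1) that]], of "{a<..<b}"])
          (use that d in auto)
      show "twice_diff_on {a<..<b} (\<lambda>x. - sl x)"
        using DERIV_minus[OF twice_diff_on_D(1)[OF lo(1)]] dd by (rule twice_diff_onI)
      fix t assume t: "a < t" "t < b" "- sl t < - u t"
      then have "p t (u t) = sl t" using le[of t] by (simp add: p_def)
      then have "f t (sl t) < F t (u t)" using t by (simp add: F_def)
      then have "w t * f t (sl t) < w t * F t (u t)" using w(1) t by simp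
      then show "deriv (deriv (\<lambda>x. - sl x)) t < - (- F t (u t) * w t)"
        using lo2[OF t(1,2)] DERIV_imp_deriv[OF dd[OF t(1,2)]] by (simp add: mult.commute)
    qed (use uv lo cont uc in \<open>auto intro: continuous_intros\<close>)
    then show ?thesis by simp
  qed
  have "is_sol \<alpha> a b f u"
    unfolding is_sol_def
  proof (intro conjI ballI uv)
    fix t assume "t \<in> {a<..<b}"
    then have t: "a < t" "t < b" by auto
    \<comment> \<open>Inside the strip the projection is the identity and the penalty vanishes; the
      conformable factor then cancels \<open>w\<close>.\<close>
    have "p t (u t) = u t" using le_su[of t] le_sl[of t] t by (simp add: p_def)
    then have "F t (u t) = f t (u t)" by (simp add: F_def)
    then have "conf_has_deriv2 \<alpha> a u t (- f t (u t))"
      using conf_has_deriv_DERIV[OF t(1) ddu[OF t], of "\<alpha> - 1"] w(2)[OF t(1)]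
      by (simp add: conf_has_deriv2_def mult.left_commute)
    then show "\<exists>L. conf_has_deriv2 \<alpha> a u t L \<and> L + f t (u t) = 0" by force
  qed
  with AC td le_su le_sl show ?thesis by blast
qed

end
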